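(* Let $k\geq 2$ and $n\geq 3$ be integers. Then \[ M_k(n)^{1/n}\leq \mu_k\leq \bigl(n\, M_k(n)\bigr)^{1/n}. \]
   Context: Words are finite sequences over the alphabet $[k]=\{1,\dots,k\}$. For words $v\in[k]^m$ and $w\in[k]^n$, a map from $v$ to $w$ is a strictly increasing function $f\colon[m]\to[n]$ with $v[i]=w[f(i)]$ for all $i$ (here $v[i]$ is the $i$-th symbol of $v$); $M(v,w)$ denotes the number of such maps (the number of occurrences of $v$ as a subsequence of $w$). Let $M(w)=\max_v M(v,w)$, the maximum over all words $v$ over $[k]$, and $M_k(n)=\min_{w\in[k]^n} M(w)$. The limit $\mu_k=\lim_{n\to\infty} M_k(n)^{1/n}$ exists. *)

theory Defs
  imports Complex_Main "HOL-Library.FuncSet"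
begin

text \<open>Words over \<open>[k]\<close> are lists with entries in \<open>{1..k}\<close>. Positions are counted
  from 0, as usual for lists.\<close>

definition words :: "nat \<Rightarrow> nat list set" where
  "words k = {w. set w \<subseteq> {1..k}}"

definition words_of_length :: "nat \<Rightarrow> nat \<Rightarrow> nat list set" where
  "words_of_length k n = {w \<in> words k. length w = n}"

text \<open>Maps are extensional functions (undefined outside the positions of \<open>v\<close>), so that
  distinct elements of this set are distinct as functions on the positions of \<open>v\<close>.\<close>

definition word_maps :: "'a list \<Rightarrow> 'a list \<Rightarrow> (nat \<Rightarrow> nat) set" where
  "word_maps v w = {f \<in> {..<length v} \<rightarrow>\<^sub>E {..<length w}.
     strict_mono_on {..<length v} f \<and> (\<forall>i<length v. v ! i = w ! f i)}"

definition num_maps :: "'a list \<Rightarrow> 'a list \<Rightarrow> nat" where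
  "num_maps v w = card (word_maps v w)"

definition max_maps :: "nat \<Rightarrow> nat list \<Rightarrow> nat" where
  "max_maps k w = Max ((\<lambda>v. num_maps v w) ` words k)"

definition min_max_maps :: "nat \<Rightarrow> nat \<Rightarrow> nat" where
  "min_max_maps k n = Min (max_maps k ` words_of_length k n)"

definition mu :: "nat \<Rightarrow> real" where
  "mu k = lim (\<lambda>n. real (min_max_maps k n) powr (1 / real n))"

text \<open>The set of words \<open>v\<close> in the maximum is infinite, but the set of values is finite;
  together with the facts below this makes the uses of \<open>Max\<close> and \<open>Min\<close> meaningful.\<close>

lemma finite_word_maps: "finite (word_maps v w)"
proof (rule finite_subset)
  show "word_maps v w \<subseteq> {..<length v} \<rightarrow>\<^sub>E {..<length w}"
    unfolding word_maps_def by blast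
  show "finite ({..<length v} \<rightarrow>\<^sub>E {..<length w})"
    by (simp add: finite_PiE)
qed

lemma word_maps_longer:
  assumes "length w < length v"
  shows "word_maps v w = {}"
proof -
  have False if "f \<in> word_maps v w" for f
  proof -
    have "f ` {..<length v} \<subseteq> {..<length w}"
      using that unfolding word_maps_def by (fastforce simp: PiE_iff)
    moreover have "inj_on f {..<length v}"
      using that unfolding word_maps_def by (simp add: strict_mono_on_imp_inj_on)
    ultimately have "card {..<length v} \<le> card {..<length w}"
      by (metis card_inj_on_le finite_lessThan)
    with assms show False by simp
  qed
  then show ?thesis by blast
qed

lemma finite_num_maps_image: "finite ((\<lambda>v. num_maps v w) ` words k)"
proof -
  have "finite {v. set v \<subseteq> {1..k} \<and> length v \<le> length w}"
    by (rule finite_lists_length_le) simp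
  moreover have "(\<lambda>v. num_maps v w) ` words k \<subseteq>
      insert 0 ((\<lambda>v. num_maps v w) ` {v. set v \<subseteq> {1..k} \<and> length v \<le> length w})"
  proof
    fix x assume "x \<in> (\<lambda>v. num_maps v w) ` words k"
    then obtain v where v: "v \<in> words k" "x = num_maps v w" by blast
    show "x \<in> insert 0 ((\<lambda>v. num_maps v w) ` {v. set v \<subseteq> {1..k} \<and> length v \<le> length w})"
    proof (cases "length w < length v")
      case True
      then show ?thesis using v word_maps_longer[OF True] by (simp add: num_maps_def)
    next
      case False
      then show ?thesis using v by (simp add: words_def)
    qed
  qed
  ultimately show ?thesis
    by (meson finite.insertI finite_imageI finite_subset)
qed

lemma words_nonempty: "words k \<noteq> {}"
proof -
  have "[] \<in> words k"
    by (simp add: words_def)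
  then show ?thesis by blast
qed

lemma finite_words_of_length: "finite (words_of_length k n)"
  unfolding words_of_length_def words_def
  using finite_lists_length_eq[of "{1..k}" n] by (simp del: One_nat_def)

lemma words_of_length_nonempty:
  assumes "k \<ge> 1"
  shows "words_of_length k n \<noteq> {}"
proof -
  have "replicate n 1 \<in> words_of_length k n"
    using assms by (simp add: words_of_length_def words_def set_replicate_conv_if)
  then show ?thesis by blast
qed

end

theory Submission imports Defs begin

text \<open>
  Concatenation makes \<open>M\<^sub>k\<close> supermultiplicative, so \<open>\<mu>\<^sub>k = sup\<^sub>n M\<^sub>k(n)\<^bsup>1/n\<^esup>\<close> by Fekete's
  argument; this is the lower bound. For the upper bound let \<open>w\<close> be an optimal word of length \<open>n\<close>.
  A map into \<open>w\<^sup>N\<close> splits \<open>v\<close> into a piece for each copy of \<open>w\<close>. A piece of length \<open>0\<close> or \<open>n\<close> admits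
  at most one map, so if \<open>M(w) \<ge> 2\<close>, summing over the length of a piece gives at most
  \<open>2 + (n - 1) M(w) \<le> n M(w)\<close> and hence \<open>M(w\<^sup>N) \<le> (n M(w))\<^sup>N\<close>.

  This fails only if the letters of \<open>w\<close> are distinct. Then \<open>n \<le> k\<close>, and one needs
  \<open>\<mu>\<^sub>k \<le> n\<^bsup>1/n\<^esup>\<close>. For \<open>n \<ge> 4\<close> this follows from the periodic word on \<open>n\<close> letters, because
  \<open>c = n\<^bsup>1/n\<^esup>\<close> satisfies \<open>c\<^bsup>n-1\<^esup> + 1 \<le> c\<^sup>n\<close>. For \<open>n = 3\<close> this inequality fails and the periodic
  word on \<open>3\<close> letters grows too fast; the word \<open>123213123213\<dots>\<close> is used instead.
\<close>

section \<open>Recursive and concatenation formulas for the number of maps\<close>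

lemma word_maps_iff:
  "f \<in> word_maps v w \<longleftrightarrow>
    (\<forall>i<length v. f i < length w \<and> v ! i = w ! f i) \<and>
    (\<forall>i. length v \<le> i \<longrightarrow> f i = undefined) \<and>
    (\<forall>i j. i < j \<longrightarrow> j < length v \<longrightarrow> f i < f j)"
  unfolding word_maps_def
  by (auto simp: PiE_iff strict_mono_on_def extensional_def Pi_iff)

lemma word_mapsD:
  assumes "f \<in> word_maps v w"
  shows "i < length v \<Longrightarrow> f i < length w" "i < length v \<Longrightarrow> v ! i = w ! f i"
    "length v \<le> i \<Longrightarrow> f i = undefined" "i < j \<Longrightarrow> j < length v \<Longrightarrow> f i < f j"
  using assms by (simp_all add: word_maps_iff)

lemma word_mapsI:
  assumes "\<And>i. i < length v \<Longrightarrow> f i < length w" "\<And>i. i < length v \<Longrightarrow> v ! i = w ! f i"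
    "\<And>i. length v \<le> i \<Longrightarrow> f i = undefined" "\<And>i j. i < j \<Longrightarrow> j < length v \<Longrightarrow> f i < f j"
  shows "f \<in> word_maps v w"
  using assms by (simp add: word_maps_iff)

lemma num_maps_Nil [simp]: "num_maps [] w = 1"
proof -
  have "word_maps [] w = {\<lambda>_. undefined}"
    by (auto simp: word_maps_iff)
  then show ?thesis by (simp add: num_maps_def)
qed

lemma num_maps_Cons_Nil [simp]: "num_maps (x # v) [] = 0"
  by (simp add: num_maps_def word_maps_longer)

text \<open>Maps are split by whether the first letter goes to position 0. Together with the two
  \<open>Nil\<close> rules this computes \<open>num_maps\<close> by recursion, so later counts need
  no explicit functions.\<close>

lemma num_maps_Cons_Cons [simp]:
  "num_maps (x # v) (y # w) = num_maps (x # v) w + (if x = y then num_maps v w else 0)"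
proof -
  define A where "A = {f \<in> word_maps (x # v) (y # w). f 0 = 0}"
  define B where "B = {f \<in> word_maps (x # v) (y # w). f 0 \<noteq> 0}"
  have fin: "finite A" "finite B"
    by (auto simp: A_def B_def finite_word_maps)
  have AB: "word_maps (x # v) (y # w) = B \<union> A" "B \<inter> A = {}"
    by (auto simp: A_def B_def)
  \<comment> \<open>The positions of \<open>x # v\<close> are exactly those with
    \<open>i \<le> length v\<close>; the value \<open>undefined\<close> elsewhere keeps the
    functions extensional. \<open>?G\<close> inverts \<open>?F\<close> only because members of
    \<open>B\<close> never take the value 0, where truncated subtraction would lose
    information.\<close>
  let ?F = "\<lambda>f i. if i \<le> length v then Suc (f i) else undefined"
  let ?G = "\<lambda>f i. if i \<le> length v then f i - 1 else undefined"
  have "bij_betw ?F (word_maps (x # v) w) B"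
  proof (rule bij_betw_byWitness[where f' = ?G])
    have pos: "f i \<noteq> 0" if "f \<in> B" "i \<le> length v" for f i
      using that word_mapsD(4)[of f "x # v" "y # w" 0 i] by (cases "i = 0") (auto simp: B_def)
    show "\<forall>f\<in>word_maps (x # v) w. ?G (?F f) = f"
      using word_mapsD(3) by fastforce
    show "\<forall>f\<in>B. ?F (?G f) = f"
    proof (intro ballI ext)
      fix f i assume "f \<in> B"
      then show "?F (?G f) i = f i"
        using pos[of f i] word_mapsD(3)[of f "x # v" "y # w" i] by (simp add: B_def)
    qed
    show "?F ` word_maps (x # v) w \<subseteq> B"
    proof clarify
      fix f assume f: "f \<in> word_maps (x # v) w"
      have "?F f \<in> word_maps (x # v) (y # w)"
        using word_mapsD[OF f] by (intro word_mapsI) simp_all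
      then show "?F f \<in> B" by (simp add: B_def)
    qed
    show "?G ` B \<subseteq> word_maps (x # v) w"
    proof clarify
      fix f assume f: "f \<in> B"
      then have f': "f \<in> word_maps (x # v) (y # w)" by (simp add: B_def)
      show "?G f \<in> word_maps (x # v) w"
      proof (rule word_mapsI)
        fix i assume i: "i < length (x # v)"
        then show "?G f i < length w" "(x # v) ! i = w ! ?G f i"
          using word_mapsD(1,2)[OF f', of i] pos[OF f, of i] by (auto simp: nth_Cons')
      next
        fix i j assume "i < j" "j < length (x # v)"
        then show "?G f i < ?G f j"
          using word_mapsD(4)[OF f', of i j] pos[OF f, of i] by simp
      qed simp
    qed
  qed
  then have B: "card B = num_maps (x # v) w"
    by (simp add: num_maps_def bij_betw_same_card)
  have A: "card A = (if x = y then num_maps v w else 0)"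
  proof (cases "x = y")
    case True
    \<comment> \<open>Once the first letter is fixed at position 0, what remains is a map from
      \<open>v\<close> to \<open>w\<close> with arguments and values both shifted by one.\<close>
    let ?F = "\<lambda>f i. case i of 0 \<Rightarrow> 0 | Suc j \<Rightarrow> if j < length v then Suc (f j) else undefined"
    let ?G = "\<lambda>f i. if i < length v then f (Suc i) - 1 else undefined"
    have "bij_betw ?F (word_maps v w) A"
    proof (rule bij_betw_byWitness[where f' = ?G])
      have pos: "f (Suc i) \<noteq> 0" if "f \<in> A" "i < length v" for f i
        using that word_mapsD(4)[of f "x # v" "y # w" 0 "Suc i"] by (simp add: A_def)
      show "\<forall>f\<in>word_maps v w. ?G (?F f) = f"
        using word_mapsD(3) by fastforce
      show "\<forall>f\<in>A. ?F (?G f) = f"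
      proof (intro ballI ext)
        fix f i assume "f \<in> A"
        then show "?F (?G f) i = f i"
          using pos[of f "i - 1"] word_mapsD(3)[of f "x # v" "y # w" i]
          by (auto simp: A_def split: nat.split)
      qed
      show "?F ` word_maps v w \<subseteq> A"
      proof clarify
        fix f assume f: "f \<in> word_maps v w"
        have "?F f \<in> word_maps (x # v) (y # w)"
        proof (rule word_mapsI)
          fix i assume "i < length (x # v)"
          then show "?F f i < length (y # w)" "(x # v) ! i = (y # w) ! ?F f i"
            using True word_mapsD(1,2)[OF f, of "i - 1"] by (auto split: nat.split)
        next
          fix i j assume "i < j" "j < length (x # v)"
          then show "?F f i < ?F f j"
            using word_mapsD(4)[OF f, of "i - 1" "j - 1"] by (auto split: nat.split)
        qed (auto split: nat.split)
        then show "?F f \<in> A" by (simp add: A_def)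
      qed
      show "?G ` A \<subseteq> word_maps v w"
      proof clarify
        fix f assume f: "f \<in> A"
        then have f': "f \<in> word_maps (x # v) (y # w)" by (simp add: A_def)
        show "?G f \<in> word_maps v w"
        proof (rule word_mapsI)
          fix i assume "i < length v"
          then show "?G f i < length w" "v ! i = w ! ?G f i"
            using word_mapsD(1,2)[OF f', of "Suc i"] pos[OF f, of i] by auto
        next
          fix i j assume "i < j" "j < length v"
          then show "?G f i < ?G f j"
            using word_mapsD(4)[OF f', of "Suc i" "Suc j"] pos[OF f, of i] by simp
        qed simp
      qed
    qed
    then show ?thesis
      using True by (simp add: num_maps_def bij_betw_same_card)
  next
    case False
    have "A = {}"
    proof (rule equals0I)
      fix f assume "f \<in> A"
      then show False
        using False word_mapsD(2)[of f "x # v" "y # w" 0] by (simp add: A_def)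
    qed
    then show ?thesis using False by simp
  qed
  show ?thesis
    using card_Un_disjoint[OF fin(2,1) AB(2)] A B by (simp add: num_maps_def AB(1))
qed

lemma num_maps_append_mono: "num_maps v w \<le> num_maps v (u @ w)"
proof (induction u arbitrary: v)
  case (Cons y u)
  then show ?case by (cases v) (auto intro: trans_le_add1)
qed simp

text \<open>A map into \<open>w\<close> and a map into \<open>w'\<close> can be placed side by side,
  and different pairs give different maps. This is the source of supermultiplicativity.\<close>

lemma num_maps_append_ge: "num_maps v w * num_maps v' w' \<le> num_maps (v @ v') (w @ w')"
proof (induction w arbitrary: v)
  case Nil
  then show ?case by (cases v) auto
next
  case (Cons y w)
  show ?case
  proof (cases v)
    case Nil
    then show ?thesis by (simp add: num_maps_append_mono flip: append_Cons)
  next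
    case (Cons x u)
    show ?thesis
      using Cons.IH[of v] Cons.IH[of u] by (auto simp: Cons distrib_right)
  qed
qed

text \<open>The index \<open>j\<close> is the number of letters of \<open>v\<close> sent into
  \<open>w\<close>; by monotonicity these letters form a prefix.\<close>

lemma num_maps_append:
  "num_maps v (w @ w') = (\<Sum>j\<le>length v. num_maps (take j v) w * num_maps (drop j v) w')"
proof (induction w arbitrary: v)
  case Nil
  show ?case
  proof (cases v)
    case (Cons x u)
    then show ?thesis by (simp add: sum.atMost_Suc_shift del: sum.atMost_Suc)
  qed simp
next
  case IH: (Cons y w)
  show ?case
  proof (cases v)
    case (Cons x u)
    show ?thesis
      using IH[of v] IH[of u]
      by (simp add: Cons sum.atMost_Suc_shift sum.distrib distrib_right del: sum.atMost_Suc)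
  qed simp
qed

lemma num_maps_le_power: "num_maps v w \<le> 2 ^ length w"
proof (induction w arbitrary: v)
  case Nil
  then show ?case by (cases v) auto
next
  case (Cons y w)
  show ?case
  proof (cases v)
    case Nil
    then show ?thesis by simp
  next
    case (Cons x u)
    show ?thesis
      using Cons.IH[of v] Cons.IH[of u] by (auto simp: Cons)
  qed
qed

lemma num_maps_longer: "length w < length v \<Longrightarrow> num_maps v w = 0"
  by (simp add: num_maps_def word_maps_longer)

lemma num_maps_same_length_le: "length v = length w \<Longrightarrow> num_maps v w \<le> 1"
  by (induction v w rule: list_induct2) (auto simp: num_maps_longer)

lemma num_maps_skip: "x \<notin> set u \<Longrightarrow> num_maps (x # v) (u @ w) = num_maps (x # v) w"
  by (induction u) auto

lemma num_maps_not_in: "x \<notin> set w \<Longrightarrow> num_maps (x # v) w = 0"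
  using num_maps_skip[of x w v "[]"] by simp

lemma num_maps_map_inj: "inj f \<Longrightarrow> num_maps (map f v) (map f w) = num_maps v w"
proof (induction w arbitrary: v)
  case Nil
  then show ?case by (cases v) auto
next
  case IH: (Cons y w)
  show ?case
  proof (cases v)
    case (Cons x u)
    show ?thesis
      using IH(1)[of v] IH(1)[of u] IH(2) by (simp add: Cons inj_eq)
  qed simp
qed

lemma num_maps_not_distinct:
  assumes "\<not> distinct w"
  obtains x where "x \<in> set w" "num_maps [x] w \<ge> 2"
proof -
  obtain xs ys zs x where w: "w = xs @ [x] @ ys @ [x] @ zs"
    using not_distinct_decomp[OF assms] by blast
  have "2 \<le> num_maps [x] (x # ys @ x # zs)"
    using num_maps_append_mono[of "[x]" "x # zs" ys] by simp
  also have "\<dots> \<le> num_maps [x] w"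
    using num_maps_append_mono[of "[x]" "x # ys @ x # zs" xs] by (simp add: w)
  finally show ?thesis using that[of x] w by simp
qed

section \<open>Extremal counts, supermultiplicativity and the limit\<close>

lemma num_maps_le_max_maps: "v \<in> words k \<Longrightarrow> num_maps v w \<le> max_maps k w"
  unfolding max_maps_def by (intro Max_ge finite_num_maps_image) auto

lemma max_maps_attained:
  obtains v where "v \<in> words k" "max_maps k w = num_maps v w"
proof -
  have "max_maps k w \<in> (\<lambda>v. num_maps v w) ` words k"
    unfolding max_maps_def using finite_num_maps_image words_nonempty by (intro Max_in) auto
  then show ?thesis using that by blast
qed

lemma min_max_maps_le: "w \<in> words_of_length k n \<Longrightarrow> min_max_maps k n \<le> max_maps k w"
  unfolding min_max_maps_def by (intro Min_le) (auto simp: finite_words_of_length)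

lemma min_max_maps_attained:
  assumes "k \<ge> 1"
  obtains w where "w \<in> words_of_length k n" "min_max_maps k n = max_maps k w"
proof -
  have "min_max_maps k n \<in> max_maps k ` words_of_length k n"
    unfolding min_max_maps_def
    using words_of_length_nonempty[OF assms] by (intro Min_in) (auto simp: finite_words_of_length)
  then show ?thesis using that by blast
qed

lemma max_maps_ge_1: "max_maps k w \<ge> 1"
  using num_maps_le_max_maps[of "[]" k w] by (simp add: words_def)

lemma min_max_maps_ge_1: "k \<ge> 1 \<Longrightarrow> min_max_maps k n \<ge> 1"
  by (metis min_max_maps_attained max_maps_ge_1)

lemma min_max_maps_le_power: "k \<ge> 1 \<Longrightarrow> min_max_maps k n \<le> 2 ^ n"
proof (elim min_max_maps_attained[where n = n])
  fix w assume w: "w \<in> words_of_length k n" "min_max_maps k n = max_maps k w"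
  obtain v where "max_maps k w = num_maps v w" by (rule max_maps_attained)
  then show ?thesis using w num_maps_le_power[of v w] by (simp add: words_of_length_def)
qed

text \<open>An optimal word of length \<open>m + n\<close> is cut after \<open>m\<close> letters.
  Best subsequences of the two halves, concatenated, occur in the whole word at least as often as
  the product of their counts.\<close>

lemma min_max_maps_supermult:
  assumes "k \<ge> 1"
  shows "min_max_maps k m * min_max_maps k n \<le> min_max_maps k (m + n)"
proof -
  obtain w where w: "w \<in> words_of_length k (m + n)" "min_max_maps k (m + n) = max_maps k w"
    using min_max_maps_attained[OF assms] .
  have "take m w \<in> words_of_length k m" "drop m w \<in> words_of_length k n"
    using w set_take_subset[of m w] set_drop_subset[of m w]
    by (auto simp: words_of_length_def words_def)
  then have "min_max_maps k m * min_max_maps k n \<le> max_maps k (take m w) * max_maps k (drop m w)"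
    by (intro mult_mono min_max_maps_le) auto
  also obtain v v' where v: "v \<in> words k" "max_maps k (take m w) = num_maps v (take m w)"
      and v': "v' \<in> words k" "max_maps k (drop m w) = num_maps v' (drop m w)"
    by (metis max_maps_attained)
  have "max_maps k (take m w) * max_maps k (drop m w) \<le> num_maps (v @ v') w"
    using num_maps_append_ge[of v "take m w" v' "drop m w"] by (simp add: v v')
  also have "\<dots> \<le> max_maps k w"
    using v v' by (intro num_maps_le_max_maps) (auto simp: words_def)
  finally show ?thesis using w by simp
qed

text \<open>Fekete's lemma: the limit is the supremum of the quotients, which the linear bound keeps
  finite.\<close>

lemma superadditive_limit:
  fixes b :: "nat \<Rightarrow> real"
  assumes add: "\<And>m n. b m + b n \<le> b (m + n)"
    and nonneg: "\<And>n. 0 \<le> b n" and le: "\<And>n. b n \<le> c * real n"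
  obtains L where "(\<lambda>n. b n / real n) \<longlonglongrightarrow> L" "\<And>n. n > 0 \<Longrightarrow> b n / real n \<le> L"
proof -
  define L where "L = (SUP n\<in>{0<..}. b n / real n)"
  have bdd: "bdd_above ((\<lambda>n. b n / real n) ` {0<..})"
    using le by (intro bdd_aboveI2[where M = c]) (simp add: divide_le_eq)
  have upper: "b n / real n \<le> L" if "n > 0" for n
    unfolding L_def using that bdd by (intro cSUP_upper) auto
  have mult: "real q * b m \<le> b (q * m)" for q m
  proof (induction q)
    case (Suc q)
    then show ?case using add[of m "q * m"] by (simp add: distrib_right)
  qed (simp add: nonneg)
  have "(\<lambda>n. b n / real n) \<longlonglongrightarrow> L"
  proof (rule order_tendstoI)
    fix y assume "y > L"
    then have "b n / real n < y" if "n \<ge> 1" for n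
      using upper[of n] that by simp
    then show "\<forall>\<^sub>F n in sequentially. b n / real n < y"
      by (rule eventually_sequentiallyI)
  next
    \<comment> \<open>A single \<open>m\<close> with quotient above \<open>y\<close> suffices:
      cutting \<open>n\<close> into \<open>n div m\<close> blocks of length \<open>m\<close> costs
      at most the factor \<open>1 - m / n\<close>, and nonnegativity lets the remaining
      \<open>n mod m\<close> be dropped.\<close>
    fix y assume "y < L"
    then obtain m where m: "m > 0" "y < b m / real m"
      unfolding L_def using bdd by (subst (asm) less_cSUP_iff) auto
    have "(\<lambda>n. (1 - real m / real n) * (b m / real m)) \<longlonglongrightarrow> (1 - 0) * (b m / real m)"
      by (intro tendsto_intros lim_const_over_n)
    then have "\<forall>\<^sub>F n in sequentially. y < (1 - real m / real n) * (b m / real m)"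
      using m by (intro order_tendstoD) auto
    then show "\<forall>\<^sub>F n in sequentially. y < b n / real n"
      using eventually_gt_at_top[of 0]
    proof eventually_elim
      case (elim n)
      have "real n \<le> real (n div m) * real m + real m"
        using m mod_less_divisor[of m n] div_mult_mod_eq[of n m]
        by (metis add_left_mono less_imp_le of_nat_add of_nat_le_iff of_nat_mult)
      then have "(real n - real m) * (b m / real m) \<le> (real (n div m) * real m) * (b m / real m)"
        using nonneg[of m] by (intro mult_right_mono) auto
      also have "\<dots> = real (n div m) * b m" using m by simp
      also have "\<dots> \<le> b (n div m * m)" by (rule mult)
      also have "\<dots> \<le> b n"
        using add[of "n div m * m" "n mod m"] nonneg[of "n mod m"] by simp
      finally have "(real n - real m) * (b m / real m) / real n \<le> b n / real n"
        by (intro divide_right_mono) auto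
      also have "(real n - real m) * (b m / real m) / real n = (1 - real m / real n) * (b m / real m)"
        using elim by (simp add: field_simps)
      finally have "(1 - real m / real n) * (b m / real m) \<le> b n / real n" .
      with elim show ?case by simp
    qed
  qed
  then show ?thesis using upper that by blast
qed

text \<open>Logarithms turn supermultiplicativity into superadditivity, and the bound
  \<open>2 ^ n\<close> gives the required linear growth. Convergence is what makes the
  \<open>lim\<close> in \<open>mu\<close> meaningful.\<close>

lemma
  assumes "k \<ge> 1"
  shows tendsto_mu: "(\<lambda>n. real (min_max_maps k n) powr (1 / real n)) \<longlonglongrightarrow> mu k"
    and powr_le_mu: "n > 0 \<Longrightarrow> real (min_max_maps k n) powr (1 / real n) \<le> mu k"
proof -
  let ?b = "\<lambda>n. ln (real (min_max_maps k n))"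
  note ge = min_max_maps_ge_1[OF assms]
  have pos: "real (min_max_maps k n) > 0" for n
    using ge[of n] by linarith
  have "?b m + ?b n \<le> ?b (m + n)" for m n
    using min_max_maps_supermult[OF assms, of m n] pos[of m] pos[of n] pos[of "m + n"]
    by (subst ln_mult_pos[symmetric]) (auto simp flip: of_nat_mult)
  moreover have "0 \<le> ?b n" for n
    using ge[of n] by simp
  moreover have "?b n \<le> ln 2 * real n" for n
  proof -
    have "?b n \<le> ln (2 ^ n)"
      using min_max_maps_le_power[OF assms, of n] pos[of n]
      by (metis ln_le_cancel_iff of_nat_le_iff of_nat_numeral of_nat_power zero_less_numeral zero_less_power)
    then show ?thesis by (simp add: ln_realpow mult.commute)
  qed
  ultimately obtain L where L: "(\<lambda>n. ?b n / real n) \<longlonglongrightarrow> L" "\<And>n. n > 0 \<Longrightarrow> ?b n / real n \<le> L"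
    using superadditive_limit[of ?b "ln 2"] by blast
  have eq: "exp (?b n / real n) = real (min_max_maps k n) powr (1 / real n)" for n
    using pos[of n] by (simp add: powr_def)
  have lim: "(\<lambda>n. real (min_max_maps k n) powr (1 / real n)) \<longlonglongrightarrow> exp L"
    using tendsto_exp[OF L(1)] by (simp only: eq)
  then have "mu k = exp L" unfolding mu_def by (rule limI)
  then show "(\<lambda>n. real (min_max_maps k n) powr (1 / real n)) \<longlonglongrightarrow> mu k"
    and "n > 0 \<Longrightarrow> real (min_max_maps k n) powr (1 / real n) \<le> mu k"
    using lim L(2)[of n] by (auto simp flip: eq)
qed

section \<open>Upper bounds on \<open>mu\<close> from families of words, and powers of a
  word\<close>

lemma mu_le_powr:
  fixes C R :: real
  assumes "k \<ge> 1" "n > 0" "R > 0" "C > 0"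
    and ex: "\<And>N. \<exists>w\<in>words_of_length k (n * N). \<forall>v\<in>words k. real (num_maps v w) \<le> C * R ^ N"
  shows "mu k \<le> R powr (1 / real n)"
proof (rule LIMSEQ_le)
  \<comment> \<open>As the full sequence converges, the lengths divisible by \<open>n\<close>
    determine the limit. Along them the factor \<open>C\<close> contributes a root that tends to
    1.\<close>
  have "filterlim (\<lambda>N. n * N) sequentially sequentially"
    using \<open>n > 0\<close> by (intro filterlim_subseq strict_monoI) simp
  from filterlim_compose[OF tendsto_mu[OF \<open>k \<ge> 1\<close>] this]
  show "(\<lambda>N. real (min_max_maps k (n * N)) powr (1 / real (n * N))) \<longlonglongrightarrow> mu k" .
  have "(\<lambda>N. C powr ((1 / real n) * (1 / real N)) * R powr (1 / real n)) \<longlonglongrightarrow>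
      C powr ((1 / real n) * 0) * R powr (1 / real n)"
    using \<open>C > 0\<close> by (intro tendsto_intros lim_const_over_n) auto
  then show "(\<lambda>N. C powr ((1 / real n) * (1 / real N)) * R powr (1 / real n)) \<longlonglongrightarrow> R powr (1 / real n)"
    using \<open>C > 0\<close> by simp
  show "\<exists>N0. \<forall>N\<ge>N0. real (min_max_maps k (n * N)) powr (1 / real (n * N))
      \<le> C powr ((1 / real n) * (1 / real N)) * R powr (1 / real n)"
  proof (intro exI[of _ 1] allI impI)
    fix N :: nat assume "N \<ge> 1"
    obtain w where w: "w \<in> words_of_length k (n * N)" "\<And>v. v \<in> words k \<Longrightarrow> real (num_maps v w) \<le> C * R ^ N"
      using ex by blast
    obtain v where v: "v \<in> words k" "max_maps k w = num_maps v w" by (rule max_maps_attained)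
    have "real (min_max_maps k (n * N)) \<le> C * R ^ N"
      using min_max_maps_le[OF w(1)] w(2)[OF v(1)] by (simp add: v(2))
    then have "real (min_max_maps k (n * N)) powr (1 / real (n * N)) \<le> (C * R ^ N) powr (1 / real (n * N))"
      by (intro powr_mono2) auto
    also have "\<dots> = C powr ((1 / real n) * (1 / real N)) * R powr (1 / real n)"
      using assms \<open>N \<ge> 1\<close> by (simp add: powr_mult powr_powr flip: powr_realpow)
    finally show "real (min_max_maps k (n * N)) powr (1 / real (n * N))
      \<le> C powr ((1 / real n) * (1 / real N)) * R powr (1 / real n)" .
  qed
qed

text \<open>Induction on \<open>N\<close> peels off the first copy of \<open>w\<close>, summing over
  the length of the prefix of \<open>v\<close> that is sent into it.\<close>

lemma num_maps_concat_replicate_le: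
  assumes M: "max_maps k w \<ge> 2" and "v \<in> words k"
  shows "num_maps v (concat (replicate N w)) \<le> (length w * max_maps k w) ^ N"
  using \<open>v \<in> words k\<close>
proof (induction N arbitrary: v)
  case 0
  then show ?case by (cases v) auto
next
  case (Suc N)
  let ?n = "length w" and ?M = "max_maps k w"
  define g where "g j = (if j = 0 \<or> j = ?n then 1 else ?M)" for j
  \<comment> \<open>An empty \<open>w\<close> would admit at most \<open>2 ^ 0\<close> maps, against
    \<open>M\<close>. Hence the two exceptional lengths 0 and \<open>?n\<close> in \<open>g\<close>
    are distinct, and only \<open>?n - 1\<close> lengths carry the weight \<open>?M\<close>.\<close>
  have n: "?n > 0"
  proof (rule ccontr)
    obtain u where "?M = num_maps u w" by (rule max_maps_attained)
    moreover assume "\<not> ?n > 0"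
    ultimately show False using M num_maps_le_power[of u w] by simp
  qed
  have sub: "take j v \<in> words k" "drop j v \<in> words k" for j
    using Suc.prems set_take_subset[of j v] set_drop_subset[of j v] by (auto simp: words_def)
  have g: "num_maps (take j v) w \<le> (if j \<le> ?n then g j else 0)" if "j \<le> length v" for j
    using that num_maps_le_max_maps[OF sub(1), of j w]
      num_maps_same_length_le[of "take j v" w] num_maps_longer[of w "take j v"]
    by (auto simp: g_def)
  have "(\<Sum>j\<le>length v. num_maps (take j v) w) \<le> (\<Sum>j\<le>length v. if j \<le> ?n then g j else 0)"
    by (intro sum_mono g) auto
  also have "\<dots> = (\<Sum>j\<in>{..length v} \<inter> {..?n}. g j)"
    by (subst sum.inter_restrict) auto
  also have "\<dots> \<le> (\<Sum>j\<le>?n. g j)"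
    by (intro sum_mono2) auto
  also have "{..?n} = insert 0 (insert ?n {1..<?n})"
    using n by auto
  also have "sum g \<dots> = 2 + (\<Sum>j\<in>{1..<?n}. g j)"
    using n by (simp add: g_def)
  also have "(\<Sum>j\<in>{1..<?n}. g j) = (?n - 1) * ?M"
    by (simp add: g_def)
  also have "2 + \<dots> \<le> ?n * ?M"
    using n M by (cases ?n) auto
  finally have sum: "(\<Sum>j\<le>length v. num_maps (take j v) w) \<le> ?n * ?M" .
  have "num_maps v (w @ concat (replicate N w)) \<le>
      (\<Sum>j\<le>length v. num_maps (take j v) w * (?n * ?M) ^ N)"
    unfolding num_maps_append by (intro sum_mono mult_left_mono Suc.IH sub) auto
  also have "\<dots> = (\<Sum>j\<le>length v. num_maps (take j v) w) * (?n * ?M) ^ N"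
    by (simp add: sum_distrib_right)
  also have "\<dots> \<le> (?n * ?M) ^ Suc N"
    using sum by simp
  finally show ?case by simp
qed

section \<open>Periodic words on at least four letters\<close>

lemma Suc_power_le_power_Suc:
  fixes m :: nat
  assumes "m \<ge> 3"
  shows "Suc m ^ m \<le> m ^ Suc m"
  using assms
proof (induction m rule: dec_induct)
  case base
  show ?case by simp
next
  case (step m)
  \<comment> \<open>The induction step rests on \<open>(m + 2) * m \<le> (m + 1)^2\<close>; the
    common factor \<open>m ^ Suc m\<close> is cancelled at the end.\<close>
  have "Suc (Suc m) ^ Suc m * m ^ Suc m = (Suc (Suc m) * m) ^ Suc m"
    by (simp only: power_mult_distrib)
  also have "\<dots> \<le> (Suc m * Suc m) ^ Suc m"
    by (intro power_mono) auto
  also have "\<dots> = Suc m ^ Suc (Suc m) * Suc m ^ m"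
    by (simp only: power_mult_distrib power_Suc mult_ac)
  also have "\<dots> \<le> Suc m ^ Suc (Suc m) * m ^ Suc m"
    by (intro mult_left_mono step.IH) auto
  finally show ?case
    using step.hyps by (simp del: power_Suc)
qed

text \<open>The indices run downwards so that increasing \<open>l\<close> adds a letter at the
  front, matching the recursion for \<open>num_maps\<close>.\<close>

definition cyclic_word :: "nat \<Rightarrow> nat \<Rightarrow> nat list" where
  "cyclic_word n l = map (\<lambda>i. Suc (i mod n)) (rev [0..<l])"

text \<open>The letter put in front of the word was last used \<open>n\<close> steps before, so the maps avoiding the new
  position number at most \<open>c\<^bsup>l-n\<^esup>\<close>.\<close>

lemma num_maps_cyclic_word_le:
  fixes c :: real
  assumes "n > 0" "c \<ge> 1" and c: "c ^ (n - 1) + 1 \<le> c ^ n"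
  shows "real (num_maps v (cyclic_word n l)) \<le> c ^ l"
proof (induction l arbitrary: v rule: less_induct)
  case (less l)
  show ?case
  proof (cases "v = [] \<or> l = 0")
    case True
    then show ?thesis using \<open>c \<ge> 1\<close> by (cases v) (auto simp: cyclic_word_def)
  next
    case False
    then obtain x u m where v: "v = x # u" and l: "l = Suc m"
      by (metis list.exhaust not0_implies_Suc)
    let ?w = "cyclic_word n m"
    have w: "cyclic_word n l = Suc (m mod n) # ?w"
      by (simp add: cyclic_word_def l)
    have IH: "real (num_maps v ?w) \<le> c ^ m" for v
      using less.IH l by simp
    show ?thesis
    proof (cases "x = Suc (m mod n)")
      case False
      have "c ^ m \<le> c ^ l"
        using \<open>c \<ge> 1\<close> by (simp add: l)
      then show ?thesis
        using False IH[of v] by (simp add: v w)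
    next
      case x: True
      have ne: "Suc (i mod n) \<noteq> x" if "i < m" "m < i + n" for i
      proof
        assume "Suc (i mod n) = x"
        then have "n dvd m - i"
          using that mod_eq_dvd_iff_nat[of i m n] by (simp add: x)
        then show False
          using that by (auto dest: dvd_imp_le)
      qed
      \<comment> \<open>Maps that use the new position number at most \<open>c ^ m\<close> by
        induction, so this is the room left for those that avoid it.\<close>
      have "real (num_maps v ?w) \<le> c ^ l - c ^ m"
      proof (cases "n - 1 \<le> m")
        case True
        \<comment> \<open>The next \<open>n - 1\<close> letters all differ from \<open>x\<close> and
          can be skipped, leaving length \<open>d = l - n\<close>. The hypothesis \<open>c\<close>,
          multiplied by \<open>c ^ d\<close>, then closes the estimate.\<close>
        define d where "d = m - (n - 1)"
        have m: "m = d + (n - 1)" using True by (simp add: d_def)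
        have "?w = map (\<lambda>i. Suc (i mod n)) (rev [d..<m]) @ cyclic_word n d"
          by (simp add: cyclic_word_def m upt_add_eq_append[of 0 d] flip: map_append rev_append)
        moreover have "x \<notin> set (map (\<lambda>i. Suc (i mod n)) (rev [d..<m]))"
          using ne m \<open>n > 0\<close> by fastforce
        ultimately have "num_maps v ?w = num_maps v (cyclic_word n d)"
          using num_maps_skip[of x _ u "cyclic_word n d"] unfolding v by metis
        also have "real \<dots> \<le> c ^ d"
          using m l by (intro less.IH) simp
        also have "\<dots> \<le> c ^ d * (c ^ n - c ^ (n - 1))"
          using c \<open>c \<ge> 1\<close> by simp
        also have "\<dots> = c ^ l - c ^ m"
          using \<open>n > 0\<close> by (simp add: l m algebra_simps flip: power_add power_Suc)
        finally show ?thesis .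
      next
        case False
        then have "\<forall>i<m. x \<noteq> Suc (i mod n)"
          using ne by fastforce
        then have "x \<notin> set ?w"
          by (auto simp: cyclic_word_def)
        then show ?thesis
          using \<open>c \<ge> 1\<close> by (simp add: v num_maps_not_in l)
      qed
      then show ?thesis
        using IH[of u] x by (simp add: v w)
    qed
  qed
qed

lemma mu_le_cyclic:
  assumes "n \<ge> 4" "n \<le> k"
  shows "mu k \<le> real n powr (1 / real n)"
proof (rule mu_le_powr)
  define c where "c = real n powr (1 / real n)"
  have c1: "c \<ge> 1"
    using assms by (simp add: c_def ge_one_powr_ge_zero)
  have cn: "c ^ n = real n"
    using assms by (simp add: c_def powr_realpow[symmetric] powr_powr)
  \<comment> \<open>Raised to the power \<open>n\<close>, this reads
    \<open>n ^ (n - 1) \<le> (n - 1) ^ n\<close>, because \<open>c ^ n = n\<close>. It is true from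
    \<open>n = 4\<close> on and false for \<open>n = 3\<close>, where 9 > 8.\<close>
  have "c ^ (n - 1) \<le> real (n - 1)"
  proof (rule power_le_imp_le_base)
    have "(c ^ (n - 1)) ^ Suc (n - 1) = real (n ^ (n - 1))"
      using assms by (simp add: cn mult.commute flip: power_mult power_Suc) (simp add: power_mult cn)
    also have "\<dots> \<le> real ((n - 1) ^ n)"
      using Suc_power_le_power_Suc[of "n - 1"] assms by (simp del: of_nat_power power_Suc)
    finally show "(c ^ (n - 1)) ^ Suc (n - 1) \<le> real (n - 1) ^ Suc (n - 1)"
      using assms by simp
  qed simp
  then have c: "c ^ (n - 1) + 1 \<le> c ^ n"
    using assms by (simp add: cn of_nat_diff)
  fix N
  have "cyclic_word n (n * N) \<in> words_of_length k (n * N)"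
    using assms less_le_trans[OF mod_less_divisor, of n k]
    by (auto simp: words_of_length_def words_def cyclic_word_def Suc_le_eq)
  moreover have "real (num_maps v (cyclic_word n (n * N))) \<le> 1 * real n ^ N" for v
    using num_maps_cyclic_word_le[OF _ c1 c, of v "n * N"] assms by (simp add: power_mult cn)
  ultimately show "\<exists>w\<in>words_of_length k (n * N). \<forall>v\<in>words k. real (num_maps v w) \<le> 1 * real n ^ N"
    by blast
qed (use assms in auto)

section \<open>The alternating word for length three\<close>

definition swap12 :: "nat \<Rightarrow> nat" where
  "swap12 x = (if x = 1 then 2 else if x = 2 then 1 else x)"

text \<open>Swapping the whole remainder lets every step prepend the same block 123, while the
  blocks of the resulting word alternate between 123 and 213.\<close>

fun alt_word :: "nat \<Rightarrow> nat list" where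
  "alt_word 0 = []"
| "alt_word (Suc N) = [1, 2, 3] @ map swap12 (alt_word N)"

text \<open>An approximate eigenvector: putting one more block of three letters in front of the word
  multiplies the largest number of maps from words with given first two letters by at most \<open>3\<close>
  relative to these integers, after the swap of \<open>1\<close> and \<open>2\<close>. Tracking only the first letter is
  not enough.\<close>

fun weight :: "nat list \<Rightarrow> nat" where
  "weight [] = 1"
| "weight [x] = 1"
| "weight (x # y # v) =
    (if x = 1 then if y = 1 then 2 else if y = 2 then 4 else if y = 3 then 3 else 1
     else if x = 2 then if y = 1 then 3 else if y = 2 then 2 else if y = 3 then 3 else 1
     else if x = 3 then if y = 1 then 2 else if y = 2 then 2 else 1
     else 1)"

text \<open>The letters 3, 2, 1 are prepended in this order. Each count unfolds into the count for
  the whole word \<open>v\<close> and that for its tail, and the leading letters of \<open>v\<close>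
  leave finitely many cases.\<close>

lemma num_maps_alt_step:
  assumes IH: "\<And>v. num_maps v w \<le> C * weight v"
  shows "num_maps v ([1, 2, 3] @ map swap12 w) \<le> 3 * C * weight v"
proof -
  let ?u = "map swap12 w"
  have inj: "inj swap12" by (auto simp: inj_def swap12_def split: if_splits)
  have inv: "map swap12 (map swap12 v) = v" for v
    by (induction v) (auto simp: swap12_def)
  \<comment> \<open>Renaming letters in both words preserves the count and \<open>swap12\<close> is
    an involution, so the hypothesis applies to the swapped \<open>v\<close>.\<close>
  have u: "num_maps v ?u \<le> C * weight (map swap12 v)" for v
    using num_maps_map_inj[OF inj, of "map swap12 v" w] IH[of "map swap12 v"] by (simp only: inv)
  have C: "1 \<le> C" using IH[of "[]"] by simp
  have u0: "num_maps (x # r) ?u \<le> C" if "x \<noteq> 1" "x \<noteq> 2" "x \<noteq> 3" for x r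
    using u[of "x # r"] that by (cases r) (auto simp: swap12_def)
  \<comment> \<open>The constants 3, 4 and 2 for first letters 1, 2 and 3 are the largest weights
    with first letter 2, 1 and 3 respectively.\<close>
  have u1: "num_maps (1 # r) ?u \<le> 3 * C" for r
    using u[of "1 # r"] C by (cases r) (auto simp: swap12_def split: if_splits)
  have u2: "num_maps (2 # r) ?u \<le> 4 * C" for r
    using u[of "2 # r"] C by (cases r) (auto simp: swap12_def split: if_splits)
  have u3: "num_maps (3 # r) ?u \<le> 2 * C" for r
    using u[of "3 # r"] C by (cases r) (auto simp: swap12_def split: if_splits)
  have heads: thesis if "r = [] \<Longrightarrow> thesis" "\<And>s. r = 1 # s \<Longrightarrow> thesis" "\<And>s. r = 2 # s \<Longrightarrow> thesis"
      "\<And>s. r = 3 # s \<Longrightarrow> thesis"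
      "\<And>x s. r = x # s \<Longrightarrow> x \<noteq> 1 \<Longrightarrow> x \<noteq> 2 \<Longrightarrow> x \<noteq> 3 \<Longrightarrow> thesis"
    for thesis and r :: "nat list"
    using that by (cases r) blast+
  have u': "num_maps r ?u \<le> (case r of [] \<Rightarrow> 1 | x # _ \<Rightarrow>
      if x = 1 then 3 else if x = 2 then 4 else if x = 3 then 2 else 1) * C" for r
    using C u0 u1 u2 u3 by (cases r rule: heads) simp_all
  \<comment> \<open>The bounds \<open>6 * C\<close> here and \<open>9 * C\<close> below do not
    depend on \<open>r\<close>; they serve when a tail beginning with 3 or 2 is counted after a
    further letter has been prepended.\<close>
  have 3: "num_maps (3 # r) (3 # ?u) \<le> 3 * C * weight (3 # r) \<and>
      num_maps (3 # r) (3 # ?u) \<le> 6 * C" for r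
    using u[of "3 # r"] u'[of r] C by (cases r rule: heads) (simp_all add: swap12_def)
  have 2: "num_maps (2 # r) (2 # 3 # ?u) \<le> 3 * C * weight (2 # r) \<and>
      num_maps (2 # r) (2 # 3 # ?u) \<le> 9 * C" for r
    using u[of "2 # r"] u'[of r] C 3[of "tl r"]
    by (cases r rule: heads) (simp_all add: swap12_def)
  have 1: "num_maps (1 # r) (1 # 2 # 3 # ?u) \<le> 3 * C * weight (1 # r)" for r
    using u[of "1 # r"] u'[of r] C 3[of "tl r"] 2[of "tl r"]
    by (cases r rule: heads) (simp_all add: swap12_def)
  show ?thesis
  proof (cases v)
    case Nil
    then show ?thesis using C by simp
  next
    case (Cons x r)
    show ?thesis
    proof (cases "x \<in> {1, 2, 3}")
      case True
      then show ?thesis using 1[of r] 2[of r] 3[of r] by (auto simp: Cons)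
    next
      case False
      then show ?thesis using u0[of x r] by (cases r) (auto simp: Cons)
    qed
  qed
qed

lemma num_maps_alt_word_le: "num_maps v (alt_word N) \<le> 3 ^ N * weight v"
proof (induction N arbitrary: v)
  case 0
  have "1 \<le> weight v" by (induction v rule: weight.induct) auto
  then show ?case by (cases v) auto
next
  case (Suc N)
  then show ?case using num_maps_alt_step[of "alt_word N" "3 ^ N"] by simp
qed

lemma mu_le_alt:
  assumes "k \<ge> 3"
  shows "mu k \<le> 3 powr (1 / 3)"
proof -
  have "mu k \<le> 3 powr (1 / real 3)"
  proof (rule mu_le_powr)
    fix N
    have "set (alt_word N) \<subseteq> {1..3}"
      by (induction N) (auto simp: swap12_def)
    moreover have "length (alt_word N) = 3 * N"
      by (induction N) auto
    ultimately have "alt_word N \<in> words_of_length k (3 * N)"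
      using assms by (auto simp: words_of_length_def words_def)
    moreover have "real (num_maps v (alt_word N)) \<le> 4 * 3 ^ N" for v
    proof -
      \<comment> \<open>The largest weight, 4, becomes the constant \<open>C\<close> of
        \<open>mu_le_powr\<close> and disappears in the limit.\<close>
      have "weight v \<le> 4" by (induction v rule: weight.induct) auto
      then have "3 ^ N * weight v \<le> 3 ^ N * 4" by (intro mult_left_mono) auto
      with num_maps_alt_word_le[of v N] have "num_maps v (alt_word N) \<le> 4 * 3 ^ N"
        by linarith
      then have "real (num_maps v (alt_word N)) \<le> real (4 * 3 ^ N)"
        by (simp only: of_nat_le_iff)
      then show ?thesis by simp
    qed
    ultimately show "\<exists>w\<in>words_of_length k (3 * N). \<forall>v\<in>words k. real (num_maps v w) \<le> 4 * 3 ^ N"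
      by blast
  qed (use assms in auto)
  then show ?thesis by simp
qed

theorem theorem1:
  fixes k n :: nat
  assumes "k \<ge> 2" and "n \<ge> 3"
  shows "real (min_max_maps k n) powr (1 / real n) \<le> mu k
    \<and> mu k \<le> (real n * real (min_max_maps k n)) powr (1 / real n)"
proof
  have k: "k \<ge> 1" using assms by simp
  show "real (min_max_maps k n) powr (1 / real n) \<le> mu k"
    using powr_le_mu[OF k, of n] assms by simp
  obtain w where w: "w \<in> words_of_length k n" "min_max_maps k n = max_maps k w"
    using min_max_maps_attained[OF k] .
  show "mu k \<le> (real n * real (min_max_maps k n)) powr (1 / real n)"
  proof (cases "distinct w")
    case True
    have "set w \<subseteq> {1..k}" "length w = n"
      using w by (auto simp: words_of_length_def words_def)
    then have "n \<le> k"
      using True card_mono[of "{1..k}" "set w"] by (simp add: distinct_card)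
    then have "mu k \<le> real n powr (1 / real n)"
      using mu_le_cyclic[of n k] mu_le_alt[of k] \<open>n \<ge> 3\<close> by (cases "n = 3") auto
    \<comment> \<open>For distinct letters the trivial bound of 1 from the empty subsequence is
      enough.\<close>
    also have "\<dots> \<le> (real n * real (min_max_maps k n)) powr (1 / real n)"
      using min_max_maps_ge_1[OF k, of n] \<open>n \<ge> 3\<close> by (intro powr_mono2) auto
    finally show ?thesis .
  next
    case False
    then obtain x where x: "x \<in> set w" "num_maps [x] w \<ge> 2"
      by (rule num_maps_not_distinct)
    have "[x] \<in> words k" using x w by (auto simp: words_of_length_def words_def)
    then have M: "max_maps k w \<ge> 2"
      using num_maps_le_max_maps x(2) order_trans by blast
    show ?thesis
    proof (rule mu_le_powr)
      show "\<exists>w\<in>words_of_length k (n * N). \<forall>v\<in>words k.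
          real (num_maps v w) \<le> 1 * (real n * real (min_max_maps k n)) ^ N" for N
      proof (intro bexI[where x = "concat (replicate N w)"] ballI)
        show "concat (replicate N w) \<in> words_of_length k (n * N)"
          using w by (auto simp: words_of_length_def words_def length_concat sum_list_replicate)
      next
        fix v assume "v \<in> words k"
        from num_maps_concat_replicate_le[OF M this, of N]
        have "num_maps v (concat (replicate N w)) \<le> (n * min_max_maps k n) ^ N"
          using w by (simp add: words_of_length_def)
        then show "real (num_maps v (concat (replicate N w))) \<le> 1 * (real n * real (min_max_maps k n)) ^ N"
          by (simp only: mult_1 of_nat_le_iff flip: of_nat_mult of_nat_power)
      qed
    qed (use assms M w in auto)
  qed
qed

end
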